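(* Let $\lambda>1$ and $\nu>0$. Suppose $u=(u_n)_{n\ge0}\in C\big([0,T_{max});\mathcal H^1\big)$ is a solution of the dyadic Navier--Stokes equation $$\partial_tu_n=-\nu\lambda^{2\alpha n}u_n+\lambda^nu_{n-1}^2-\lambda^{n+1}u_nu_{n+1},\qquad n\ge0,\quad u_{-1}:=0,$$ with $T_{max}$ its maximal time of existence, and that for some $0<\alpha<s<\frac13$, $$H_s(0)=\sum_{n=0}^\infty\lambda^{-sn}u_n(0)>C_{\alpha,s}\,\nu,$$ where $$C_{\alpha,s}=\frac{2}{\big(1-\lambda^{-(1+s)}\big)^{1/2}\big(\lambda^{1-s}-\lambda^{\frac{1+s}2}\big)\big(1-\lambda^{-(1+s-4\alpha)}\big)^{1/2}}.$$ Then this solution blows up in finite time with $$T_{max}<\frac{1}{\kappa_sH_s(0)},\qquad \kappa_s=\tfrac12\big(\lambda^{1-s}-\lambda^{\frac{1+s}2}\big)\big(1-\lambda^{-(1+s)}\big).$$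
   Context: For real sequences $u=(u_n)_{n\ge0}$, $\|u\|_{\mathcal H^s}^2=\sum_{n=0}^\infty\lambda^{2sn}u_n^2$ and $\mathcal H^s$ is the space of sequences with finite norm. No sign condition is imposed on the $u_n$. *)

theory Defs
  imports Complex_Main "HOL-Library.Extended_Real"
begin

definition Hs_space :: "real \<Rightarrow> real \<Rightarrow> (nat \<Rightarrow> real) set" where
  "Hs_space lam s = {v. summable (\<lambda>n. lam powr (2 * s * real n) * (v n)\<^sup>2)}"

text \<open>Only meaningful on \<^term>\<open>Hs_space lam s\<close>.\<close>

definition Hs_norm :: "real \<Rightarrow> real \<Rightarrow> (nat \<Rightarrow> real) \<Rightarrow> real" where
  "Hs_norm lam s v = sqrt (\<Sum>n. lam powr (2 * s * real n) * (v n)\<^sup>2)"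

definition continuous_Hs :: "real \<Rightarrow> real \<Rightarrow> real set \<Rightarrow> (real \<Rightarrow> nat \<Rightarrow> real) \<Rightarrow> bool" where
  "continuous_Hs lam s I u \<longleftrightarrow>
     (\<forall>t\<in>I. u t \<in> Hs_space lam s) \<and>
     (\<forall>t\<in>I. ((\<lambda>r. Hs_norm lam s (\<lambda>n. u r n - u t n)) \<longlongrightarrow> 0) (at t within I))"

text \<open>The end point \<^term>\<open>T\<close> may be infinite, in which case this is the half line.\<close>

definition time_interval :: "ereal \<Rightarrow> real set" where
  "time_interval T = {t. 0 \<le> t \<and> ereal t < T}"

text \<open>The case distinction encodes the convention that the component with index -1 vanishes.\<close>

definition dyadic_NS_rhs ::
    "real \<Rightarrow> real \<Rightarrow> real \<Rightarrow> (nat \<Rightarrow> real) \<Rightarrow> nat \<Rightarrow> real" where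
  "dyadic_NS_rhs lam nu alpha v n =
     - nu * lam powr (2 * alpha * real n) * v n
     + lam ^ n * (case n of 0 \<Rightarrow> 0 | Suc m \<Rightarrow> v m)\<^sup>2
     - lam ^ (n + 1) * v n * v (n + 1)"

text \<open>The equation holds componentwise, with a one-sided derivative at time 0. Values of
  \<^term>\<open>u\<close> outside the time interval are irrelevant.\<close>

definition dyadic_NS_solution ::
    "real \<Rightarrow> real \<Rightarrow> real \<Rightarrow> ereal \<Rightarrow> (real \<Rightarrow> nat \<Rightarrow> real) \<Rightarrow> bool" where
  "dyadic_NS_solution lam nu alpha T u \<longleftrightarrow>
     0 < T \<and>
     continuous_Hs lam 1 (time_interval T) u \<and>
     (\<forall>n. \<forall>t\<in>time_interval T.
        ((\<lambda>r. u r n) has_real_derivative dyadic_NS_rhs lam nu alpha (u t) n)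
          (at t within time_interval T))"

definition maximal_dyadic_NS_solution ::
    "real \<Rightarrow> real \<Rightarrow> real \<Rightarrow> ereal \<Rightarrow> (real \<Rightarrow> nat \<Rightarrow> real) \<Rightarrow> bool" where
  "maximal_dyadic_NS_solution lam nu alpha T u \<longleftrightarrow>
     dyadic_NS_solution lam nu alpha T u \<and>
     \<not> (\<exists>T' v. T < T' \<and> dyadic_NS_solution lam nu alpha T' v \<and>
               (\<forall>t\<in>time_interval T. v t = u t))"

definition H_functional :: "real \<Rightarrow> real \<Rightarrow> (nat \<Rightarrow> real) \<Rightarrow> real" where
  "H_functional lam s v = (\<Sum>n. lam powr (- s * real n) * v n)"

definition C_const :: "real \<Rightarrow> real \<Rightarrow> real \<Rightarrow> real" where
  "C_const lam alpha s =
     2 / ((1 - lam powr (- (1 + s))) powr (1 / 2)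
          * (lam powr (1 - s) - lam powr ((1 + s) / 2))
          * (1 - lam powr (- (1 + s - 4 * alpha))) powr (1 / 2))"

definition kappa_const :: "real \<Rightarrow> real \<Rightarrow> real" where
  "kappa_const lam s =
     1 / 2 * (lam powr (1 - s) - lam powr ((1 + s) / 2)) * (1 - lam powr (- (1 + s)))"

end

theory Submission
  imports Defs "HOL-Analysis.Analysis"
begin

text \<open>Write $H$ for the functional and $Q = \sum_n \lambda^{(1-s)n} u_n^2$. Differentiating $H$
  termwise, the quadratic terms contribute at least $d\,Q$ with
  $d = \lambda^{1-s} - \lambda^{(1+s)/2} > 0$, whatever the signs of the $u_n$. By Cauchy-Schwarz
  the viscous term is at most a multiple of $\nu Q^{1/2}$, and $H \le A^{-1/2} Q^{1/2}$ with
  $A = 1 - \lambda^{-(1+s)}$. The constant $C_{\alpha,s}$ is exactly what makes the viscous term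
  smaller than $d\,Q/2$ when $H > C_{\alpha,s}\nu$; this condition then persists and
  $H' > \kappa_s H^2$. Hence $1/H(t) + \kappa_s t$ is strictly decreasing, and comparing with its
  value at an intermediate time keeps the bound on the existence time strict in the limit.\<close>

section \<open>Cauchy-Schwarz for series and weighted norms\<close>

lemma Cauchy_Schwarz_suminf:
  fixes a b :: "nat \<Rightarrow> real"
  assumes a: "summable (\<lambda>n. (a n)\<^sup>2)" and b: "summable (\<lambda>n. (b n)\<^sup>2)"
  shows "summable (\<lambda>n. a n * b n)"
    and "(\<Sum>n. a n * b n)\<^sup>2 \<le> (\<Sum>n. (a n)\<^sup>2) * (\<Sum>n. (b n)\<^sup>2)"
proof -
  show ab: "summable (\<lambda>n. a n * b n)"
  proof (rule summable_comparison_test')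
    show "summable (\<lambda>n. (a n)\<^sup>2 + (b n)\<^sup>2)"
      using a b by (rule summable_add)
    show "norm (a n * b n) \<le> (a n)\<^sup>2 + (b n)\<^sup>2" for n
      using sum_squares_bound[of "\<bar>a n\<bar>" "\<bar>b n\<bar>"]
        mult_nonneg_nonneg[of "\<bar>a n\<bar>" "\<bar>b n\<bar>"]
      unfolding real_norm_def abs_mult power2_abs by linarith
  qed
  show "(\<Sum>n. a n * b n)\<^sup>2 \<le> (\<Sum>n. (a n)\<^sup>2) * (\<Sum>n. (b n)\<^sup>2)"
  proof (rule LIMSEQ_le)
    show "(\<lambda>N. (\<Sum>n<N. a n * b n)\<^sup>2) \<longlonglongrightarrow> (\<Sum>n. a n * b n)\<^sup>2"
      by (intro tendsto_power summable_LIMSEQ ab)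
    show "(\<lambda>N. (\<Sum>n<N. (a n)\<^sup>2) * (\<Sum>n<N. (b n)\<^sup>2)) \<longlonglongrightarrow> (\<Sum>n. (a n)\<^sup>2) * (\<Sum>n. (b n)\<^sup>2)"
      by (intro tendsto_mult summable_LIMSEQ a b)
  qed (blast intro: Cauchy_Schwarz_ineq_sum)
qed

lemma powr_geometric_sums:
  fixes lam p :: real
  assumes "lam > 1" "p > 0"
  shows "(\<lambda>n. lam powr (- p * real n)) sums (1 / (1 - lam powr (- p)))"
proof -
  have "(\<lambda>n. (lam powr (- p)) ^ n) sums (1 / (1 - lam powr (- p)))"
    using assms by (intro geometric_sums) (simp add: powr_less_one)
  moreover have "(lam powr (- p)) ^ n = lam powr (- p * real n)" for n
    using assms by (simp add: powr_power mult.commute)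
  ultimately show ?thesis by simp
qed

lemma Hs_space_diff:
  assumes "v \<in> Hs_space lam s" "w \<in> Hs_space lam s"
  shows "(\<lambda>n. v n - w n) \<in> Hs_space lam s"
  unfolding Hs_space_def mem_Collect_eq
proof (rule summable_comparison_test')
  show "summable (\<lambda>n. 2 * (lam powr (2 * s * real n) * (v n)\<^sup>2)
      + 2 * (lam powr (2 * s * real n) * (w n)\<^sup>2))"
    using assms unfolding Hs_space_def by (intro summable_add summable_mult) auto
  show "norm (lam powr (2 * s * real n) * (v n - w n)\<^sup>2)
      \<le> 2 * (lam powr (2 * s * real n) * (v n)\<^sup>2)
      + 2 * (lam powr (2 * s * real n) * (w n)\<^sup>2)" for n
  proof -
    have "(v n - w n)\<^sup>2 \<le> 2 * (v n)\<^sup>2 + 2 * (w n)\<^sup>2"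
      using zero_le_power2[of "v n + w n"] by (simp add: power2_eq_square algebra_simps)
    from mult_left_mono[OF this, of "lam powr (2 * s * real n)"] show ?thesis
      by (simp add: algebra_simps)
  qed
qed

text \<open>One term of a nonnegative series is at most its sum. This turns control of the norm into
  geometric decay of the components, which later dominates the series of derivatives.\<close>

lemma abs_le_Hs_norm:
  assumes "lam > 0" "v \<in> Hs_space lam s"
  shows "\<bar>v n\<bar> \<le> Hs_norm lam s v * lam powr (- s * real n)"
proof -
  have "lam powr (2 * s * real n) * (v n)\<^sup>2 \<le> (\<Sum>k. lam powr (2 * s * real k) * (v k)\<^sup>2)"
    using sum_le_suminf[of "\<lambda>k. lam powr (2 * s * real k) * (v k)\<^sup>2" "{n}"] assms(2)
    unfolding Hs_space_def by simp
  moreover have "lam powr (2 * s * real n) * (v n)\<^sup>2 = (lam powr (s * real n) * v n)\<^sup>2"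
    using assms(1) by (simp add: power_mult_distrib powr_power mult_ac)
  ultimately have "\<bar>lam powr (s * real n) * v n\<bar> \<le> Hs_norm lam s v"
    unfolding Hs_norm_def by (metis real_sqrt_abs real_sqrt_le_iff)
  then show ?thesis
    using assms(1) by (simp add: abs_mult powr_minus field_simps)
qed

text \<open>For \<open>q \<le> 2\<close> the weight is dominated by that of the H^1 norm. It is
  placed inside the square because Cauchy-Schwarz is applied to these terms.\<close>

lemma H1_imp_weighted_summable:
  assumes "lam > 1" "v \<in> Hs_space lam 1" "q \<le> 2"
  shows "summable (\<lambda>n. (lam powr (q / 2 * real n) * v n)\<^sup>2)"
proof (rule summable_comparison_test')
  show "summable (\<lambda>n. lam powr (2 * 1 * real n) * (v n)\<^sup>2)"
    using assms(2) unfolding Hs_space_def by auto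
  show "norm ((lam powr (q / 2 * real n) * v n)\<^sup>2) \<le> lam powr (2 * 1 * real n) * (v n)\<^sup>2" for n
    using assms by (auto simp: power_mult_distrib powr_power intro!: mult_right_mono powr_mono)
qed

text \<open>The weight \<open>lam powr (b * real n)\<close> is split as
  \<open>lam powr (- (1 - s - 2 * b) / 2 * real n)\<close> times
  \<open>lam powr ((1 - s) / 2 * real n)\<close>; the squares of the first factor form a geometric
  series. The choice \<open>b = - s\<close> bounds the functional and yields the exponent
  \<open>1 + s\<close>; \<open>b = 2 * alpha - s\<close> bounds the viscous sum and yields
  \<open>1 + s - 4 * alpha\<close>.\<close>

lemma weighted_sum_sq_le:
  fixes lam s b :: real
  assumes lam: "lam > 1" and v: "v \<in> Hs_space lam 1" and s: "s \<ge> -1" and b: "1 - s - 2 * b > 0"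
  shows "summable (\<lambda>n. lam powr (b * real n) * v n)"
    and "(1 - lam powr (- (1 - s - 2 * b))) * (\<Sum>n. lam powr (b * real n) * v n)\<^sup>2
       \<le> (\<Sum>n. (lam powr ((1 - s) / 2 * real n) * v n)\<^sup>2)"
proof -
  let ?a = "\<lambda>n. lam powr (- ((1 - s - 2 * b) / 2) * real n)"
  let ?w = "\<lambda>n. lam powr ((1 - s) / 2 * real n) * v n"
  have aw: "?a n * ?w n = lam powr (b * real n) * v n" for n
  proof -
    have "- ((1 - s - 2 * b) / 2) * real n + (1 - s) / 2 * real n = b * real n"
      by (simp add: field_simps)
    then show ?thesis by (simp flip: powr_add mult.assoc)
  qed
  have a2: "(?a n)\<^sup>2 = lam powr (- (1 - s - 2 * b) * real n)" for n
    unfolding power2_eq_square powr_add[symmetric]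
    by (rule arg_cong[where f = "\<lambda>x. lam powr x"]) (simp add: field_simps)
  have ga: "(\<lambda>n. (?a n)\<^sup>2) sums (1 / (1 - lam powr (- (1 - s - 2 * b))))"
    unfolding a2 using lam b by (rule powr_geometric_sums)
  have sw: "summable (\<lambda>n. (?w n)\<^sup>2)"
    using H1_imp_weighted_summable[OF lam v, of "1 - s"] s by simp
  note CS = Cauchy_Schwarz_suminf[OF sums_summable[OF ga] sw, unfolded aw]
  show "summable (\<lambda>n. lam powr (b * real n) * v n)" by (rule CS)
  have "0 < 1 - lam powr (- (1 - s - 2 * b))"
    using lam b by (simp add: powr_less_one)
  then show "(1 - lam powr (- (1 - s - 2 * b))) * (\<Sum>n. lam powr (b * real n) * v n)\<^sup>2
       \<le> (\<Sum>n. (?w n)\<^sup>2)"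
    using CS(2) unfolding sums_unique[OF ga, symmetric] by (simp add: field_simps)
qed

section \<open>Growth of the functional at a fixed state\<close>

text \<open>The rescaling \<open>w\<close> is chosen so that both quadratic terms get coefficients
  independent of \<open>n\<close>. Summation then leaves multiples of only two quantities, the sum
  of squares and the sum of neighbouring products.\<close>

lemma weighted_rhs_eq:
  fixes lam nu alpha s :: real
  assumes "lam > 0"
  defines "w \<equiv> \<lambda>v n. lam powr ((1 - s) / 2 * real n) * v n"
  shows "lam powr (- s * real n) * dyadic_NS_rhs lam nu alpha v n =
    - nu * (lam powr ((2 * alpha - s) * real n) * v n)
    + (case n of 0 \<Rightarrow> 0 | Suc m \<Rightarrow> lam powr (1 - s) * (w v m)\<^sup>2)
    - lam powr ((1 + s) / 2) * (w v n * w v (Suc n))"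
proof -
  have 1: "lam powr (- s * real n) * lam powr (2 * alpha * real n)
      = lam powr ((2 * alpha - s) * real n)"
    by (simp add: algebra_simps flip: powr_add)
  have 2: "lam powr (- s * real n) * lam ^ n * (case n of 0 \<Rightarrow> 0 | Suc m \<Rightarrow> v m)\<^sup>2
      = (case n of 0 \<Rightarrow> 0 | Suc m \<Rightarrow> lam powr (1 - s) * (w v m)\<^sup>2)"
  proof (cases n)
    case (Suc m)
    have "lam powr (- s * real n) * lam ^ n = lam powr (- s * real n + real n)"
      using assms by (simp only: powr_add powr_realpow)
    also have "\<dots> = lam powr ((1 - s) + 2 * ((1 - s) / 2 * real m))"
      unfolding Suc by (rule arg_cong[where f = "\<lambda>x. lam powr x"]) (simp add: field_simps)
    also have "\<dots> = lam powr (1 - s) * (lam powr ((1 - s) / 2 * real m))\<^sup>2"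
      using assms by (simp only: powr_add mult_2 power2_eq_square)
    finally show ?thesis
      unfolding Suc w_def by (simp add: power_mult_distrib)
  qed simp
  have 3: "lam powr (- s * real n) * lam ^ (n + 1)
      = lam powr ((1 + s) / 2) * (lam powr ((1 - s) / 2 * real n) * lam powr ((1 - s) / 2 * real (Suc n)))"
  proof -
    have "lam powr (- s * real n) * lam ^ (n + 1) = lam powr (- s * real n + real (n + 1))"
      using assms by (simp only: powr_add powr_realpow)
    also have "- s * real n + real (n + 1)
        = (1 + s) / 2 + ((1 - s) / 2 * real n + (1 - s) / 2 * real (Suc n))"
      by (simp add: field_simps)
    finally show ?thesis by (simp only: powr_add)
  qed
  have "lam powr (- s * real n) * dyadic_NS_rhs lam nu alpha v n =
      - nu * (lam powr (- s * real n) * lam powr (2 * alpha * real n) * v n)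
      + lam powr (- s * real n) * lam ^ n * (case n of 0 \<Rightarrow> 0 | Suc m \<Rightarrow> v m)\<^sup>2
      - lam powr (- s * real n) * lam ^ (n + 1) * v n * v (n + 1)"
    unfolding dyadic_NS_rhs_def by (simp add: algebra_simps)
  then show ?thesis
    unfolding 1 2 3 by (simp add: w_def mult_ac)
qed

text \<open>No time enters here. Half of \<open>d * Q\<close> absorbs the viscous term; the other
  half is at least \<open>d * A / 2\<close> times the square of the functional, and
  \<open>d * A / 2\<close> is \<open>kappa_const lam s\<close>.\<close>

lemma H_functional_growth:
  fixes lam nu alpha s :: real
  assumes lam: "lam > 1" and nu: "nu > 0" and v: "v \<in> Hs_space lam 1"
    and alpha: "0 < alpha" "alpha < s" and s: "s < 1 / 3"
    and H: "H_functional lam s v > C_const lam alpha s * nu"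
  shows "kappa_const lam s * (H_functional lam s v)\<^sup>2
    < (\<Sum>n. lam powr (- s * real n) * dyadic_NS_rhs lam nu alpha v n)"
proof -
  define w where "w n = lam powr ((1 - s) / 2 * real n) * v n" for n
  define Q where "Q = (\<Sum>n. (w n)\<^sup>2)"
  define P where "P = (\<Sum>n. w n * w (Suc n))"
  define L where "L = (\<Sum>n. lam powr ((2 * alpha - s) * real n) * v n)"
  define h where "h = H_functional lam s v"
  define A where "A = 1 - lam powr (- (1 + s))"
  define B where "B = 1 - lam powr (- (1 + s - 4 * alpha))"
  define d where "d = lam powr (1 - s) - lam powr ((1 + s) / 2)"
  \<comment> \<open>Both uses of \<open>s < 1 / 3\<close> are here: it is equivalent to
    \<open>1 - s > (1 + s) / 2\<close>, hence \<open>d > 0\<close>, and together with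
    \<open>alpha < s\<close> it gives \<open>1 + s - 4 * alpha > 0\<close>, hence
    \<open>B > 0\<close>.\<close>
  have A: "A > 0" and B: "B > 0" and d: "d > 0"
    unfolding A_def B_def d_def using lam alpha s by (auto simp: powr_less_one)
  have sw: "summable (\<lambda>n. (w n)\<^sup>2)"
    unfolding w_def using H1_imp_weighted_summable[OF lam v, of "1 - s"] alpha by simp
  have Q: "(\<lambda>n. (w n)\<^sup>2) sums Q"
    unfolding Q_def using sw by (rule summable_sums)
  have sw1: "summable (\<lambda>n. (w (Suc n))\<^sup>2)"
    using sw by (subst summable_Suc_iff)
  have sP: "summable (\<lambda>n. w n * w (Suc n))"
    by (rule Cauchy_Schwarz_suminf[OF sw sw1])
  have Q0: "Q \<ge> 0" unfolding Q_def by (intro suminf_nonneg sw) simp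
  \<comment> \<open>The shifted sum of squares lacks only the term at index 0, so it is at most
    \<open>Q\<close>. Working with the square of \<open>P\<close> makes the signs of the
    \<open>w n\<close> irrelevant.\<close>
  have "P\<^sup>2 \<le> Q * (\<Sum>n. (w (Suc n))\<^sup>2)"
    unfolding P_def Q_def by (rule Cauchy_Schwarz_suminf[OF sw sw1])
  also have "\<dots> \<le> Q * Q"
    using suminf_split_head[OF sw] Q0 by (intro mult_left_mono) (auto simp: Q_def)
  finally have PQ: "P \<le> Q"
    by (intro power2_le_imp_le[OF _ Q0]) (simp only: power2_eq_square)
  have AH: "A * h\<^sup>2 \<le> Q"
    using weighted_sum_sq_le(2)[OF lam v, of s "- s"] alpha
    unfolding A_def h_def H_functional_def Q_def w_def by (simp add: algebra_simps)
  have BL: "B * L\<^sup>2 \<le> Q" and sL: "summable (\<lambda>n. lam powr ((2 * alpha - s) * real n) * v n)"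
    using weighted_sum_sq_le[OF lam v, of s "2 * alpha - s"] alpha s
    unfolding B_def L_def Q_def w_def by (simp_all add: algebra_simps)
  \<comment> \<open>The gain term is the series of squares shifted by one with a zero in front, so
    all of \<open>Q\<close> reappears.\<close>
  have "(\<lambda>n. case n of 0 \<Rightarrow> 0 | Suc m \<Rightarrow> lam powr (1 - s) * (w m)\<^sup>2) sums (lam powr (1 - s) * Q)"
    by (subst sums_Suc_iff[symmetric, where s = "lam powr (1 - s) * Q" 
          and f = "\<lambda>n. case n of 0 \<Rightarrow> 0 | Suc m \<Rightarrow> lam powr (1 - s) * (w m)\<^sup>2", simplified])
       (intro sums_mult Q)
  then have "(\<lambda>n. lam powr (- s * real n) * dyadic_NS_rhs lam nu alpha v n)
      sums (- nu * L + lam powr (1 - s) * Q - lam powr ((1 + s) / 2) * P)"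
    unfolding weighted_rhs_eq[OF less_trans[OF zero_less_one lam]] w_def[symmetric]
    unfolding L_def P_def by (intro sums_diff sums_add sums_mult summable_sums sL sP)
  then have D: "(\<Sum>n. lam powr (- s * real n) * dyadic_NS_rhs lam nu alpha v n)
      = - nu * L + lam powr (1 - s) * Q - lam powr ((1 + s) / 2) * P"
    by (simp add: sums_iff)
  define q where "q = sqrt Q"
  have q: "q\<^sup>2 = Q" "q \<ge> 0" unfolding q_def using Q0 by auto
  have hC: "h > 2 / (sqrt A * d * sqrt B) * nu"
    using H A B unfolding C_const_def A_def[symmetric] B_def[symmetric] d_def[symmetric] h_def[symmetric]
    by (simp add: powr_half_sqrt)
  then have h0: "h > 0"
    using A B d nu by (smt (verit) divide_pos_pos mult_pos_pos real_sqrt_gt_zero)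
  have qh: "sqrt A * h \<le> q"
    using AH h0 unfolding q_def by (metis real_sqrt_le_iff real_sqrt_mult real_sqrt_abs abs_of_pos)
  have "sqrt B * \<bar>L\<bar> \<le> q"
    using BL unfolding q_def by (metis real_sqrt_le_iff real_sqrt_mult real_sqrt_abs)
  then have Lq: "\<bar>L\<bar> \<le> q / sqrt B"
    using B by (simp add: field_simps)
  \<comment> \<open>The viscous loss is at most \<open>nu * q / sqrt B\<close> and has to stay below
    \<open>d * q * q / 2\<close>, that is, \<open>2 * nu / sqrt B < d * q\<close>. Since
    \<open>q\<close> is at least \<open>sqrt A * h\<close>, a lower bound on \<open>h\<close>
    suffices, and solving for it gives \<open>C_const\<close>.\<close>
  have "2 * nu / sqrt B < d * (sqrt A * h)"
    using hC A B d by (simp add: field_simps)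
  also have "\<dots> \<le> d * q" using qh d by simp
  finally have dq: "2 * (nu / sqrt B) < d * q" by simp
  have q0: "q > 0" using qh h0 A by (smt (verit) mult_pos_pos real_sqrt_gt_zero)
  have "nu * L \<le> nu * (q / sqrt B)"
    using Lq nu by (intro mult_left_mono) auto
  also have "\<dots> = (nu / sqrt B) * q" by simp
  also have "\<dots> < d / 2 * Q"
    using mult_strict_right_mono[OF dq q0] by (simp add: power2_eq_square mult_ac flip: q(1))
  finally have "nu * L < d / 2 * Q" .
  moreover have "lam powr ((1 + s) / 2) * P \<le> lam powr ((1 + s) / 2) * Q"
    using PQ by (intro mult_left_mono) auto
  moreover have "1 / 2 * d * A * h\<^sup>2 \<le> d / 2 * Q"
    using mult_left_mono[OF AH, of "d / 2"] d by simp
  ultimately show ?thesis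
    unfolding D kappa_const_def A_def[symmetric] d_def[symmetric] h_def[symmetric]
    by (simp add: d_def algebra_simps)
qed

section \<open>Termwise differentiation of the functional\<close>

text \<open>This supplies the majorant for the Weierstrass test. The quadratic terms decay like
  \<open>lam powr (- (1 + s) * real n)\<close>; the viscous term is the slowest and dictates the
  rate.\<close>

lemma abs_weighted_rhs_le:
  fixes lam nu alpha s M :: real
  assumes lam: "lam > 1" and nu: "nu > 0" and alpha: "0 < alpha"
    and v: "\<And>n. \<bar>v n\<bar> \<le> M * lam powr (- real n)"
  shows "\<bar>lam powr (- s * real n) * dyadic_NS_rhs lam nu alpha v n\<bar>
    \<le> (nu * M + M\<^sup>2 * lam\<^sup>2 + M\<^sup>2) * lam powr (- (1 + s - 2 * alpha) * real n)"
proof -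
  define r where "r = lam powr (- (1 + s - 2 * alpha) * real n)"
  have le_r: "lam powr (- (1 + s) * real n) \<le> r"
    unfolding r_def using lam alpha by (intro powr_mono mult_right_mono) auto
  have "\<bar>lam powr (2 * alpha * real n - s * real n) * v n\<bar>
      \<le> lam powr (2 * alpha * real n - s * real n) * (M * lam powr (- real n))"
    unfolding abs_mult using v[of n] by (intro mult_mono) auto
  also have "\<dots> = M * r"
    unfolding r_def by (simp add: algebra_simps flip: powr_add)
  finally have 1: "\<bar>lam powr (2 * alpha * real n - s * real n) * v n\<bar> \<le> M * r" .
  have 2: "lam powr (- s * real n) * lam ^ n * (case n of 0 \<Rightarrow> 0 | Suc m \<Rightarrow> v m)\<^sup>2 \<le> M\<^sup>2 * lam\<^sup>2 * r"
  proof (cases n)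
    case 0
    then show ?thesis unfolding r_def by simp
  next
    \<comment> \<open>Replacing \<open>m\<close> by \<open>n - 1\<close> in the decay of the squared
      component costs two powers of \<open>lam\<close>, whence the factor \<open>lam\<^sup>2\<close>
      in the bound.\<close>
    case (Suc m)
    have "(v m)\<^sup>2 \<le> (M * lam powr (- real m))\<^sup>2"
      using power_mono[OF v[of m], of 2] by simp
    then have "lam powr (- s * real n) * lam ^ n * (v m)\<^sup>2
        \<le> lam powr (- s * real n) * lam ^ n * (M * lam powr (- real m))\<^sup>2"
      using lam by (intro mult_left_mono) auto
    also have "\<dots> = M\<^sup>2 * (lam powr (- s * real n) * lam powr real n * (lam powr (- real m) * lam powr (- real m)))"
      using lam by (simp add: powr_realpow power2_eq_square)
    also have "\<dots> = M\<^sup>2 * lam powr (2 + - (1 + s) * real n)"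
      unfolding Suc powr_add[symmetric] by (simp add: algebra_simps)
    also have "\<dots> = M\<^sup>2 * (lam\<^sup>2 * lam powr (- (1 + s) * real n))"
      using lam by (simp only: powr_add) (simp add: powr_numeral)
    also have "\<dots> \<le> M\<^sup>2 * lam\<^sup>2 * r"
      unfolding mult.assoc using le_r by (intro mult_left_mono) auto
    finally show ?thesis using Suc by simp
  qed
  have "\<bar>lam powr (- s * real n) * lam ^ (n + 1) * (v n * v (n + 1))\<bar>
      \<le> lam powr (- s * real n) * lam ^ (n + 1)
        * ((M * lam powr (- real n)) * (M * lam powr (- real (n + 1))))"
    unfolding abs_mult
    using v[of n] v[of "n + 1"] lam by (intro mult_mono) (auto simp: order_trans[OF abs_ge_zero])
  also have "\<dots> = M\<^sup>2 * (lam powr (- s * real n) * lam powr real (n + 1)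
        * (lam powr (- real n) * lam powr (- real (n + 1))))"
    using lam by (simp only: powr_realpow) (simp add: power2_eq_square)
  also have "\<dots> = M\<^sup>2 * lam powr (- (1 + s) * real n)"
    unfolding powr_add[symmetric] by (simp add: algebra_simps)
  also have "\<dots> \<le> M\<^sup>2 * r"
    using le_r by (simp add: mult_left_mono)
  finally have 3: "\<bar>lam powr (- s * real n) * lam ^ (n + 1) * (v n * v (n + 1))\<bar> \<le> M\<^sup>2 * r" .
  have "lam powr (- s * real n) * dyadic_NS_rhs lam nu alpha v n =
      - nu * (lam powr (2 * alpha * real n - s * real n) * v n)
      + lam powr (- s * real n) * lam ^ n * (case n of 0 \<Rightarrow> 0 | Suc m \<Rightarrow> v m)\<^sup>2
      - lam powr (- s * real n) * lam ^ (n + 1) * (v n * v (n + 1))"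
    unfolding dyadic_NS_rhs_def diff_conv_add_uminus powr_add by (simp add: algebra_simps)
  moreover have "\<bar>nu * (lam powr (2 * alpha * real n - s * real n) * v n)\<bar> \<le> nu * (M * r)"
    using 1 nu by (simp add: abs_mult)
  moreover have "0 \<le> lam powr (- s * real n) * lam ^ n * (case n of 0 \<Rightarrow> 0 | Suc m \<Rightarrow> v m)\<^sup>2"
    using lam by simp
  ultimately have "\<bar>lam powr (- s * real n) * dyadic_NS_rhs lam nu alpha v n\<bar>
      \<le> nu * (M * r) + M\<^sup>2 * lam\<^sup>2 * r + M\<^sup>2 * r"
    using 2 3 by linarith
  then show ?thesis unfolding r_def[symmetric] by (simp add: algebra_simps)
qed

text \<open>Differentiating under the sum requires uniform convergence of the derivative series. H^1
  continuity bounds the norm near \<open>t\<close>, so it suffices to argue in a neighbourhood of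
  \<open>t\<close>.\<close>

lemma H_functional_has_derivative:
  fixes lam nu alpha s :: real
  assumes lam: "lam > 1" and nu: "nu > 0" and alpha: "0 < alpha" "2 * alpha < 1 + s" and s: "s > -1"
    and sol: "dyadic_NS_solution lam nu alpha T u" and t: "t \<in> time_interval T"
  shows "((\<lambda>r. H_functional lam s (u r)) has_real_derivative
      (\<Sum>n. lam powr (- s * real n) * dyadic_NS_rhs lam nu alpha (u t) n)) (at t within time_interval T)"
proof -
  define I where "I = time_interval T"
  have mem: "u r \<in> Hs_space lam 1" if "r \<in> I" for r
    using sol that unfolding dyadic_NS_solution_def continuous_Hs_def I_def by blast
  have "((\<lambda>r. Hs_norm lam 1 (\<lambda>n. u r n - u t n)) \<longlongrightarrow> 0) (at t within I)"
    using sol t unfolding dyadic_NS_solution_def continuous_Hs_def I_def by blast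
  then have "\<forall>\<^sub>F r in at t within I. Hs_norm lam 1 (\<lambda>n. u r n - u t n) < 1"
    by (rule order_tendstoD) simp
  then obtain e where e: "e > 0"
    and norm_lt: "\<And>r. r \<in> I \<Longrightarrow> r \<noteq> t \<Longrightarrow> dist r t < e \<Longrightarrow> Hs_norm lam 1 (\<lambda>n. u r n - u t n) < 1"
    unfolding eventually_at by auto
  \<comment> \<open>Intersecting with a ball keeps the set convex, as the series theorem demands,
    and does not change the filter at \<open>t\<close>. At \<open>t = 0\<close> the derivative
    remains one-sided.\<close>
  define S where "S = I \<inter> ball t e"
  \<comment> \<open>The norm at \<open>t\<close> plus the distance bound 1, by the triangle
    inequality: one constant for all of \<open>S\<close>.\<close>
  define M where "M = Hs_norm lam 1 (u t) + 1"
  have tS: "t \<in> S" unfolding S_def I_def using t e by simp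
  have bound: "\<bar>u r n\<bar> \<le> M * lam powr (- real n)" if "r \<in> S" for r n
  \<comment> \<open>The limit along \<open>at t within I\<close> says nothing about \<open>t\<close>
    itself.\<close>
  proof (cases "r = t")
    case True
    then show ?thesis
      using abs_le_Hs_norm[of lam "u t" 1 n] mem[of t] t lam unfolding I_def M_def
      by (simp add: distrib_right add_increasing2)
  next
    case False
    have "\<bar>u r n - u t n\<bar> \<le> Hs_norm lam 1 (\<lambda>n. u r n - u t n) * lam powr (- 1 * real n)"
      using abs_le_Hs_norm[of lam "\<lambda>n. u r n - u t n" 1 n] Hs_space_diff mem that tS lam
      unfolding S_def by auto
    also have "\<dots> \<le> 1 * lam powr (- 1 * real n)"
      using norm_lt[of r] that False unfolding S_def
      by (intro mult_right_mono) (auto simp: dist_commute)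
    finally have "\<bar>u r n - u t n\<bar> \<le> lam powr (- real n)" by simp
    moreover have "\<bar>u t n\<bar> \<le> Hs_norm lam 1 (u t) * lam powr (- real n)"
      using abs_le_Hs_norm[of lam "u t" 1 n] mem[of t] t lam unfolding I_def by simp
    ultimately show ?thesis unfolding M_def distrib_right by linarith
  qed
  have "convex I"
    unfolding I_def time_interval_def is_interval_convex_1[symmetric] is_interval_1
    by (auto intro: order.strict_trans1[OF ereal_less_eq(3)[THEN iffD2]])
  then have "convex S" unfolding S_def by (intro convex_Int convex_ball)
  let ?D = "\<lambda>n r. lam powr (- s * real n) * dyadic_NS_rhs lam nu alpha (u r) n"
  have unif: "uniform_limit S (\<lambda>N r. \<Sum>n<N. ?D n r) (\<lambda>r. \<Sum>n. ?D n r) sequentially"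
  proof (rule Weierstrass_m_test)
    show "norm (?D n r) \<le> (nu * M + M\<^sup>2 * lam\<^sup>2 + M\<^sup>2) * lam powr (- (1 + s - 2 * alpha) * real n)"
      if "r \<in> S" for n r
      using abs_weighted_rhs_le[OF lam nu alpha(1) bound[OF that]] by simp
    show "summable (\<lambda>n. (nu * M + M\<^sup>2 * lam\<^sup>2 + M\<^sup>2) * lam powr (- (1 + s - 2 * alpha) * real n))"
      using powr_geometric_sums[of lam "1 + s - 2 * alpha"] lam alpha
      by (intro summable_mult) (auto dest: sums_summable)
  qed
  have der: "((\<lambda>r. lam powr (- s * real n) * u r n) has_real_derivative ?D n r) (at r within S)"
    if "r \<in> S" for n r
  proof -
    have "((\<lambda>r. u r n) has_real_derivative dyadic_NS_rhs lam nu alpha (u r) n) (at r within S)"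
      using sol that unfolding dyadic_NS_solution_def S_def I_def
      by (blast intro: has_field_derivative_subset)
    then show ?thesis by (rule DERIV_cmult)
  qed
  have "summable (\<lambda>n. lam powr (- s * real n) * u t n)"
    using weighted_sum_sq_le(1)[OF lam mem[of t], of s "- s"] s t unfolding I_def by simp
  from has_field_derivative_series[OF \<open>convex S\<close> der unif tS this]
  obtain g where g: "\<And>r. r \<in> S \<Longrightarrow> (\<lambda>n. lam powr (- s * real n) * u r n) sums g r"
    and g': "\<And>r. r \<in> S \<Longrightarrow> (g has_real_derivative (\<Sum>n. ?D n r)) (at r within S)"
    by auto
  have "((\<lambda>r. H_functional lam s (u r)) has_real_derivative (\<Sum>n. ?D n t)) (at t within S)"
    by (rule has_field_derivative_transform_within[OF g'[OF tS] zero_less_one tS])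
       (use g in \<open>auto simp: H_functional_def sums_iff\<close>)
  moreover have "at t within S = at t within I"
    unfolding S_def using e by (intro at_within_nhd[of t "ball t e"]) auto
  ultimately show ?thesis unfolding I_def by simp
qed

section \<open>The scalar differential inequality\<close>

text \<open>Positivity of the derivative is known only where \<open>h > c\<close>, so a first-exit
  argument is needed: before the first time \<open>z\<close> with \<open>h z \<le> c\<close> the
  function increases, which forces \<open>h z > h a > c\<close>.\<close>

lemma superlevel_invariant:
  fixes h D :: "real \<Rightarrow> real"
  assumes der: "\<And>t. a \<le> t \<Longrightarrow> t \<le> b \<Longrightarrow> (h has_real_derivative D t) (at t within {a..b})"
    and pos: "\<And>t. a \<le> t \<Longrightarrow> t \<le> b \<Longrightarrow> h t > c \<Longrightarrow> D t > 0"
    and init: "h a > c" and t: "t \<in> {a..b}"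
  shows "h t > c"
proof (rule ccontr)
  assume "\<not> h t > c"
  have cont: "continuous_on {a..b} h"
    using der by (auto intro!: DERIV_continuous_on)
  define Z where "Z = {a..b} \<inter> h -` {..c}"
  \<comment> \<open>Compactness of the set of bad times guarantees that a first one exists.\<close>
  have "closed Z"
    unfolding Z_def by (intro continuous_closed_preimage cont) auto
  moreover have "bounded Z" by (rule bounded_subset[of "{a..b}"]) (auto simp: Z_def)
  ultimately have "compact Z" by (simp add: compact_eq_bounded_closed)
  moreover have "t \<in> Z" using t \<open>\<not> h t > c\<close> unfolding Z_def by auto
  ultimately obtain z where z: "z \<in> Z" and min: "\<And>y. y \<in> Z \<Longrightarrow> z \<le> y"
    using compact_attains_inf[of Z] by blast
  have z': "z \<le> b" "h z \<le> c" "a < z"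
    using z init unfolding Z_def by (auto simp: less_eq_real_def)
  have "h a < h z"
  proof (rule DERIV_pos_imp_increasing_open[OF \<open>a < z\<close>])
    fix x assume x: "a < x" "x < z"
    then have "x \<notin> Z" using min[of x] by auto
    then have "D x > 0" using pos[of x] x z' unfolding Z_def by auto
    moreover have "(h has_real_derivative D x) (at x)"
      using der[of x] x z' at_within_Icc_at[of a x b] by simp
    ultimately show "\<exists>y. (h has_real_derivative y) (at x) \<and> 0 < y" by blast
  qed (use cont z' in \<open>auto intro: continuous_on_subset\<close>)
  with init z' show False by simp
qed

text \<open>The derivative of \<open>1 / h t + k * t\<close> is
  \<open>- D t / (h t)\<^sup>2 + k\<close>, negative wherever the inequality holds. Since
  \<open>k \<ge> 0\<close>, the inequality also makes \<open>D\<close> positive above level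
  \<open>c\<close>, so the level is never left and the inequality holds throughout.\<close>

lemma riccati_strict_decreasing:
  fixes h D :: "real \<Rightarrow> real"
  assumes der: "\<And>t. a \<le> t \<Longrightarrow> t \<le> b \<Longrightarrow> (h has_real_derivative D t) (at t within {a..b})"
    and ineq: "\<And>t. a \<le> t \<Longrightarrow> t \<le> b \<Longrightarrow> h t > c \<Longrightarrow> D t > k * (h t)\<^sup>2"
    and init: "h a > c" and c: "c \<ge> 0" and k: "k \<ge> 0"
    and xy: "a \<le> x" "x < y" "y \<le> b"
  shows "h x > 0" "h y > 0" "1 / h y + k * y < 1 / h x + k * x"
proof -
  have pos: "h t > c" if "t \<in> {a..b}" for t
  proof (rule superlevel_invariant[OF der _ init that])
    show "D t > 0" if "a \<le> t" "t \<le> b" "h t > c" for t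
      using ineq[OF that] k by (smt (verit) zero_le_power2 mult_nonneg_nonneg)
  qed
  show "h x > 0" "h y > 0" using pos[of x] pos[of y] xy c by auto
  have cont: "continuous_on {x..y} h"
    by (rule continuous_on_subset[of "{a..b}"], rule DERIV_continuous_on[OF der]) (use xy in auto)
  show "1 / h y + k * y < 1 / h x + k * x"
  proof (rule DERIV_neg_imp_decreasing_open[OF \<open>x < y\<close>])
    fix t assume t: "x < t" "t < y"
    then have t': "t \<in> {a..b}" using xy by auto
    have ht: "h t > 0" using pos[OF t'] c by simp
    have "(h has_real_derivative D t) (at t)"
      using der[of t] t xy at_within_Icc_at[of a t b] by simp
    then have "((\<lambda>t. 1 / h t + k * t) has_real_derivative (- D t / (h t)\<^sup>2 + k)) (at t)"
      using ht by (auto intro!: derivative_eq_intros simp: power2_eq_square)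
    moreover have "- D t / (h t)\<^sup>2 + k < 0"
      using ineq[of t] pos[OF t'] t' ht by (simp add: field_simps)
    ultimately show "\<exists>z. ((\<lambda>t. 1 / h t + k * t) has_real_derivative z) (at t) \<and> z < 0" by blast
  next
    show "continuous_on {x..y} (\<lambda>t. 1 / h t + k * t)"
      using pos xy c
      by (intro continuous_intros cont ballI less_imp_neq[symmetric])
         (metis atLeastAtMost_iff le_less_trans order_trans)
  qed
qed

section \<open>The bound on the existence time\<close>

theorem theorem2p6:
  fixes lam nu alpha s :: real
    and Tmax :: ereal
    and u :: "real \<Rightarrow> nat \<Rightarrow> real"
  assumes "lam > 1" and "nu > 0"
    and "maximal_dyadic_NS_solution lam nu alpha Tmax u"
    and "0 < alpha" and "alpha < s" and "s < 1 / 3"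
    and "H_functional lam s (u 0) > C_const lam alpha s * nu"
  shows "Tmax < \<infinity> \<and>
         Tmax < ereal (1 / (kappa_const lam s * H_functional lam s (u 0)))"
proof -
  define h where "h t = H_functional lam s (u t)" for t
  define D where "D t = (\<Sum>n. lam powr (- s * real n) * dyadic_NS_rhs lam nu alpha (u t) n)" for t
  define k where "k = kappa_const lam s"
  define c where "c = C_const lam alpha s * nu"
  have k: "k > 0"
    unfolding k_def kappa_const_def using assms by (simp add: powr_less_one)
  have c: "c \<ge> 0"
    unfolding c_def C_const_def using assms by (simp add: less_imp_le)
  have sol: "dyadic_NS_solution lam nu alpha Tmax u"
    using assms(3) unfolding maximal_dyadic_NS_solution_def by blast
  have T0: "0 < Tmax" using sol unfolding dyadic_NS_solution_def by blast
  have decr: "h 0 > 0 \<and> h y > 0 \<and> 1 / h y + k * y < 1 / h x + k * x"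
    if xy: "0 \<le> x" "x < y" "ereal y < Tmax" for x y
  proof -
    have I: "{0..y} \<subseteq> time_interval Tmax"
      using xy unfolding time_interval_def
      by (auto intro: order.strict_trans1[OF ereal_less_eq(3)[THEN iffD2]])
    have der: "(h has_real_derivative D t) (at t within {0..y})" if "0 \<le> t" "t \<le> y" for t
      unfolding h_def D_def using I assms that
      by (intro has_field_derivative_subset[OF H_functional_has_derivative[OF assms(1,2,4) _ _ sol] I])
         auto
    have ineq: "D t > k * (h t)\<^sup>2" if "0 \<le> t" "t \<le> y" "h t > c" for t
    proof -
      have "u t \<in> Hs_space lam 1"
        using sol I that unfolding dyadic_NS_solution_def continuous_Hs_def by auto
      then show ?thesis
        using H_functional_growth[of lam nu "u t" alpha s] assms that
        unfolding D_def h_def k_def c_def by auto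
    qed
    have init: "h 0 > c" using assms unfolding h_def c_def by simp
    show ?thesis
      using riccati_strict_decreasing[OF der ineq init c, of x y] k xy init c by auto
  qed
  \<comment> \<open>Letting \<open>y\<close> tend to \<open>Tmax\<close> in a comparison with time 0
    would give only a weak inequality. The strict loss up to the fixed time \<open>x\<close> leaves
    room for a constant \<open>K\<close> strictly below the claimed bound.\<close>
  obtain x where x: "0 < x" "ereal x < Tmax"
    using ereal_dense2[OF T0] by auto
  have h0: "h 0 > 0" and gap: "1 / h x + k * x < 1 / h 0"
    using decr[of 0 x] x by auto
  define K where "K = (1 / h x + k * x) / k"
  have "K < 1 / (k * h 0)"
    unfolding K_def using divide_strict_right_mono[OF gap k] by (simp add: mult.commute)
  have hx: "h x > 0" using decr[of 0 x] x by simp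
  \<comment> \<open>For \<open>y \<le> x\<close> the bound holds because \<open>K\<close> is
    \<open>x\<close> plus a positive term; for later \<open>y\<close> the comparison with
    \<open>x\<close> applies and the positive \<open>1 / h y\<close> is dropped.\<close>
  have le_K: "y \<le> K" if "ereal y < Tmax" for y
  proof (cases "y \<le> x")
    case True
    then show ?thesis using k hx unfolding K_def by (simp add: field_simps add_increasing)
  next
    case False
    then have "1 / h y + k * y < 1 / h x + k * x" "h y > 0" using decr[of x y] x that by auto
    then have "k * y \<le> 1 / h x + k * x" by (smt (verit) divide_pos_pos)
    then show ?thesis using k unfolding K_def by (simp add: field_simps)
  qed
  \<comment> \<open>A real time strictly between \<open>K\<close> and \<open>Tmax\<close> would
    exist even for infinite \<open>Tmax\<close>, so this also gives finiteness.\<close>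
  have "Tmax \<le> ereal K"
  proof (rule ccontr)
    assume "\<not> Tmax \<le> ereal K"
    then obtain y where "ereal K < ereal y" "ereal y < Tmax"
      using ereal_dense2[of "ereal K" Tmax] by (auto simp: not_le)
    then show False using le_K[of y] by simp
  qed
  also have "ereal K < ereal (1 / (k * h 0))" using \<open>K < 1 / (k * h 0)\<close> by simp
  finally have "Tmax < ereal (1 / (k * h 0))" .
  then show ?thesis unfolding k_def h_def by auto
qed

end
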